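(* For every positive integer $n$, the $n \times n$ square can be tiled with T-tetrominos and at most $5$ monominos.
   Context: A T-tetromino is a polyomino made of four unit squares, three in a row and a fourth attached to the middle square of that row on one side, in any rotation or reflection. A monomino is a single unit square. A tiling of a region made of unit lattice squares is a placement of tiles aligned with the unit grid such that the tiles are pairwise non-overlapping and their union is exactly the region. *)

theory Defs
  imports Main
begin

text \<open>A unit lattice square \<open>[x, x + 1] \<times> [y, y + 1]\<close> is represented by its lower left corner \<open>(x, y)\<close>,
  and a region or placed tile by the set of its unit squares.\<close>

type_synonym cell = "int \<times> int"

definition T_tetrominoes :: "cell set set" where
  "T_tetrominoes =
     {{(x - 1, y), (x, y), (x + 1, y), (x, y + s)} | x y s. s \<in> {1, -1}} \<union>
     {{(x, y - 1), (x, y), (x, y + 1), (x + s, y)} | x y s. s \<in> {1, -1}}"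

definition monominoes :: "cell set set" where
  "monominoes = {{c} | c. True}"

definition tiling :: "cell set set \<Rightarrow> cell set set \<Rightarrow> cell set \<Rightarrow> bool" where
  "tiling tiles P R \<longleftrightarrow> P \<subseteq> tiles \<and> pairwise disjnt P \<and> \<Union>P = R"

definition square :: "nat \<Rightarrow> cell set" where
  "square n = {0..<int n} \<times> {0..<int n}"

end

theory Submission
  imports Defs
begin

text \<open>
  If \<open>n\<close> is not a multiple of 4, write \<open>n = m + w\<close> with \<open>4 dvd m\<close> and a fixed width \<open>w \<in> {6, 15, 17}\<close>.
  The lower left \<open>m \<times> m\<close> square is tiled by \<open>4 \<times> 4\<close> blocks. What remains is a horizontal strip of width
  \<open>w\<close> along the top, a vertical one along the right, and a \<open>w \<times> w\<close> corner. Infinite strips of these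
  widths have a periodic tiling without monominoes, of period 4 for \<open>w = 6\<close> and 16 otherwise. It is cut
  along a ragged profile, so that whole periods can be inserted. Closing a strip with a straight end
  costs one monomino; filling the corner between the ragged ends of the two strips costs two
  (\<open>w = 6\<close>) or three. This leaves finitely many tilings to be exhibited: the ends for each residue of \<open>m\<close>
  modulo the period, the periods, the corners, and the squares too small to be split in this way. They
  were found with a SAT solver.
\<close>

section \<open>Tileable regions\<close>

text \<open>An upper bound rather than an exact count, so that costs of pieces can simply be added.
  \<open>card\<close> is 0 on infinite sets, so the bound is meaningful for finite regions, and all
  regions built below are finite.\<close>

definition tileable :: "cell set \<Rightarrow> nat \<Rightarrow> bool" where
  "tileable R g \<longleftrightarrow>
     (\<exists>P. tiling (T_tetrominoes \<union> monominoes) P R \<and> card (P \<inter> monominoes) \<le> g)"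

lemma tileable_mono: "tileable R g \<Longrightarrow> g \<le> h \<Longrightarrow> tileable R h"
  unfolding tileable_def using order_trans by blast

lemma tileable_empty: "tileable {} 0"
  unfolding tileable_def tiling_def by (intro exI[of _ "{}"]) auto

lemma tileable_Un:
  assumes "tileable R g" and "tileable R' g'" and "R \<inter> R' = {}"
  shows "tileable (R \<union> R') (g + g')"
proof -
  obtain P P' where P: "tiling (T_tetrominoes \<union> monominoes) P R" "card (P \<inter> monominoes) \<le> g"
    and P': "tiling (T_tetrominoes \<union> monominoes) P' R'" "card (P' \<inter> monominoes) \<le> g'"
    using assms(1,2) unfolding tileable_def by blast
  have sub: "t \<subseteq> R" "t' \<subseteq> R'" if "t \<in> P" "t' \<in> P'" for t t'
    using that P(1) P'(1) unfolding tiling_def by auto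
  have disj: "disjnt t t'" "disjnt t' t" if "t \<in> P" "t' \<in> P'" for t t'
    using sub[OF that] assms(3) unfolding disjnt_def by auto
  have "pairwise disjnt (P \<union> P')"
    using P(1) P'(1) disj unfolding tiling_def pairwise_def by (metis Un_iff)
  then have "tiling (T_tetrominoes \<union> monominoes) (P \<union> P') (R \<union> R')"
    using P(1) P'(1) unfolding tiling_def by auto
  moreover have "card ((P \<union> P') \<inter> monominoes) \<le> g + g'"
    using card_Un_le[of "P \<inter> monominoes" "P' \<inter> monominoes"] P(2) P'(2)
    by (simp add: Int_Un_distrib2)
  ultimately show ?thesis
    unfolding tileable_def by blast
qed

lemma tileable_image:
  fixes f :: "cell \<Rightarrow> cell"
  assumes f: "inj f" and T: "\<And>t. t \<in> T_tetrominoes \<Longrightarrow> f ` t \<in> T_tetrominoes"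
    and R: "tileable R g"
  shows "tileable (f ` R) g"
proof -
  obtain P where P: "tiling (T_tetrominoes \<union> monominoes) P R" "card (P \<inter> monominoes) \<le> g"
    using R unfolding tileable_def by blast
  \<comment> \<open>With both directions, the monominoes of the image tiling are exactly the images
    of those of \<open>P\<close>, and injectivity preserves their number.\<close>
  have M: "f ` t \<in> monominoes \<longleftrightarrow> t \<in> monominoes" for t
  proof
    assume "f ` t \<in> monominoes"
    then obtain c where "f ` t = {c}"
      unfolding monominoes_def by blast
    then obtain d where "t = {d}"
      using f by (metis card_1_singletonE card_image inj_on_subset is_singletonI
          is_singleton_altdef subset_UNIV)
    then show "t \<in> monominoes"
      unfolding monominoes_def by blast
  qed (auto simp: monominoes_def)
  have "disjnt (f ` s) (f ` t)" if "s \<in> P" "t \<in> P" "f ` s \<noteq> f ` t" for s t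
  proof -
    have "disjnt s t"
      using P(1) that unfolding tiling_def pairwise_def by metis
    then show ?thesis
      using f unfolding disjnt_def by (simp add: image_Int[symmetric])
  qed
  then have "pairwise disjnt ((`) f ` P)"
    unfolding pairwise_def by blast
  then have "tiling (T_tetrominoes \<union> monominoes) ((`) f ` P) (f ` R)"
    using P(1) T M unfolding tiling_def by (auto simp: subset_iff image_Union)
  moreover have "(`) f ` P \<inter> monominoes = (`) f ` (P \<inter> monominoes)"
    using M by auto
  moreover have "inj_on ((`) f) (P \<inter> monominoes)"
    using f by (simp add: inj_on_def inj_image_eq_iff)
  ultimately show ?thesis
    unfolding tileable_def using P(2) by (metis card_image)
qed

section \<open>Translations and the reflection in the diagonal\<close>

definition shift :: "int \<Rightarrow> int \<Rightarrow> cell set \<Rightarrow> cell set" where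
  "shift a b R = (\<lambda>(x, y). (x + a, y + b)) ` R"

lemma mem_shift_iff: "(x, y) \<in> shift a b R \<longleftrightarrow> (x - a, y - b) \<in> R"
  unfolding shift_def by force

lemma mem_swap_iff: "(x, y) \<in> prod.swap ` R \<longleftrightarrow> (y, x) \<in> R"
  by force

lemma T_tetromino_cases:
  assumes "t \<in> T_tetrominoes"
  obtains (horizontal) x y s where "s \<in> {1, -1}" "t = {(x - 1, y), (x, y), (x + 1, y), (x, y + s)}"
  | (vertical) x y s where "s \<in> {1, -1}" "t = {(x, y - 1), (x, y), (x, y + 1), (x + s, y)}"
  using assms unfolding T_tetrominoes_def by blast

lemma horizontal_T_tetromino:
  "s \<in> {1, -1} \<Longrightarrow> {(x - 1, y), (x, y), (x + 1, y), (x, y + s)} \<in> T_tetrominoes"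
  unfolding T_tetrominoes_def by blast

lemma vertical_T_tetromino:
  "s \<in> {1, -1} \<Longrightarrow> {(x, y - 1), (x, y), (x, y + 1), (x + s, y)} \<in> T_tetrominoes"
  unfolding T_tetrominoes_def by blast

lemma tileable_shift:
  assumes "tileable R g"
  shows "tileable (shift a b R) g"
  unfolding shift_def
proof (rule tileable_image[OF _ _ assms])
  show "inj (\<lambda>(x, y). (x + a, y + b))"
    by (auto simp: inj_on_def)
  show "(\<lambda>(x, y). (x + a, y + b)) ` t \<in> T_tetrominoes" if "t \<in> T_tetrominoes" for t
    using that
  proof (cases rule: T_tetromino_cases)
    case (horizontal x y s)
    then show ?thesis
      using horizontal_T_tetromino[of s "x + a" "y + b"] by (simp add: algebra_simps)
  next
    case (vertical x y s)
    then show ?thesis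
      using vertical_T_tetromino[of s "x + a" "y + b"] by (simp add: algebra_simps)
  qed
qed

text \<open>Reflection in the diagonal exchanges the horizontal and the vertical family of
  T-tetrominoes.\<close>

lemma tileable_swap:
  assumes "tileable R g"
  shows "tileable (prod.swap ` R) g"
proof (rule tileable_image[OF _ _ assms])
  show "prod.swap ` t \<in> T_tetrominoes" if "t \<in> T_tetrominoes" for t
    using that
  proof (cases rule: T_tetromino_cases)
    case (horizontal x y s)
    then show ?thesis
      using vertical_T_tetromino[of s y x] by simp
  next
    case (vertical x y s)
    then show ?thesis
      using horizontal_T_tetromino[of s y x] by simp
  qed
qed auto

section \<open>Tilings given by lists of shapes\<close>

text \<open>
  A tiling is encoded by the shapes of its tiles, ordered by their lexicographically least cell: that
  cell is always the first one not yet covered, so no positions need to be recorded. \<open>M\<close> is a monomino;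
  the other letters name the side on which the fourth square is attached to the row of three.
\<close>

datatype shape = M | N | S | E | W

fun other_cells :: "shape \<Rightarrow> cell \<Rightarrow> cell list" where
  "other_cells M (x, y) = []"
| "other_cells N (x, y) = [(x + 1, y), (x + 1, y + 1), (x + 2, y)]"
| "other_cells S (x, y) = [(x + 1, y - 1), (x + 1, y), (x + 2, y)]"
| "other_cells E (x, y) = [(x, y + 1), (x, y + 2), (x + 1, y + 1)]"
| "other_cells W (x, y) = [(x + 1, y - 1), (x + 1, y), (x + 1, y + 1)]"

text \<open>A single pass suffices because \<open>other_cells\<close> and the cell lists used below
  are both in lexicographic order. \<open>None\<close> signals a tile that leaves the region or hits
  a covered cell.\<close>

fun remove_sublist :: "'a list \<Rightarrow> 'a list \<Rightarrow> 'a list option" where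
  "remove_sublist [] cs = Some cs"
| "remove_sublist (x # xs) [] = None"
| "remove_sublist (x # xs) (c # cs) =
     (if x = c then remove_sublist xs cs else map_option ((#) c) (remove_sublist (x # xs) cs))"

fun shapes_cover :: "shape list \<Rightarrow> cell list \<Rightarrow> bool" where
  "shapes_cover [] cs \<longleftrightarrow> cs = []"
| "shapes_cover (d # ds) [] \<longleftrightarrow> False"
| "shapes_cover (d # ds) (c # cs) \<longleftrightarrow>
     (case remove_sublist (other_cells d c) cs of None \<Rightarrow> False | Some rs \<Rightarrow> shapes_cover ds rs)"

text \<open>Distinctness ensures that a deleted cell does not occur again later in the list. The
  order of the list affects only whether the deletion succeeds, not its soundness.\<close>

lemma remove_sublist_Some:
  assumes "remove_sublist xs cs = Some rs" and "distinct cs"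
  shows "set cs = set xs \<union> set rs \<and> set xs \<inter> set rs = {} \<and> distinct rs"
  using assms
proof (induction xs cs arbitrary: rs rule: remove_sublist.induct)
  case (3 x xs c cs)
  show ?case
  proof (cases "x = c")
    case True
    then show ?thesis
      using 3 by auto
  next
    case False
    then obtain rs' where "remove_sublist (x # xs) cs = Some rs'" "rs = c # rs'"
      using "3.prems"(1) by auto
    then show ?thesis
      using False "3.IH"(2)[of rs'] "3.prems"(2) by auto
  qed
qed auto

lemma tileable_single_shape:
  "tileable (insert c (set (other_cells d c))) (if d = M then 1 else 0)"
proof -
  define t where "t = insert c (set (other_cells d c))"
  obtain x y where c: "c = (x, y)"
    by force
  have t: "if d = M then t = {c} else t \<in> T_tetrominoes"
  \<comment> \<open>T-tetrominoes are indexed by the centre of the row of three, shapes by their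
    least cell \<open>c\<close>. For \<open>N\<close> and \<open>S\<close> this is the left end of
    the row, for \<open>E\<close> the lower end; for \<open>W\<close> it is the attached
    square.\<close>
  proof (cases d)
    case N
    then show ?thesis
      using horizontal_T_tetromino[of 1 "x + 1" y] by (simp add: t_def c insert_commute add.commute)
  next
    case S
    then show ?thesis
      using horizontal_T_tetromino[of "-1" "x + 1" y] by (simp add: t_def c insert_commute add.commute)
  next
    case E
    then show ?thesis
      using vertical_T_tetromino[of 1 x "y + 1"] by (simp add: t_def c insert_commute add.commute)
  next
    case W
    then show ?thesis
      using vertical_T_tetromino[of "-1" "x + 1" y] by (simp add: t_def c insert_commute add.commute)
  qed (simp add: t_def c)
  have "t \<notin> monominoes" if "t \<in> T_tetrominoes"
    using that by (cases rule: T_tetromino_cases) (auto simp: monominoes_def)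
  then have "tiling (T_tetrominoes \<union> monominoes) {t} t"
    and "card ({t} \<inter> monominoes) \<le> (if d = M then 1 else 0)"
    using t unfolding tiling_def by (auto simp: monominoes_def split: if_splits)
  then show ?thesis
    unfolding tileable_def t_def by blast
qed

text \<open>Soundness of the encoding: each step splits off one tile, disjoint from the cells that
  remain, and each \<open>M\<close> contributes one to the count.\<close>

lemma tileable_of_shapes:
  assumes "shapes_cover ds cs" and "distinct cs"
  shows "tileable (set cs) (count_list ds M)"
  using assms
proof (induction ds cs rule: shapes_cover.induct)
  case (1 cs)
  then show ?case
    by (simp add: tileable_empty)
next
  case (3 d ds c cs)
  then obtain rs where rs: "remove_sublist (other_cells d c) cs = Some rs" "shapes_cover ds rs"
    by (auto split: option.splits)
  have *: "set cs = set (other_cells d c) \<union> set rs" "set (other_cells d c) \<inter> set rs = {}" "distinct rs"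
    using remove_sublist_Some[OF rs(1)] "3.prems"(2) by auto
  then have "insert c (set (other_cells d c)) \<inter> set rs = {}"
    using "3.prems"(2) by auto
  then have "tileable (insert c (set (other_cells d c)) \<union> set rs)
      ((if d = M then 1 else 0) + count_list ds M)"
    using tileable_Un[OF tileable_single_shape[of c d] "3.IH"[OF rs(1) rs(2) *(3)]] by blast
  moreover have "set (c # cs) = insert c (set (other_cells d c)) \<union> set rs"
    using *(1) by auto
  ultimately show ?case
    by (auto split: if_splits)
qed auto

section \<open>Periodic strips\<close>

text \<open>
  \<open>Q\<close> is the profile: the cells right of the cutting line that belong to tiles on its left, relative
  to the line.
\<close>

definition strip_end :: "int \<Rightarrow> cell set \<Rightarrow> int \<Rightarrow> cell set" where
  "strip_end w Q m = {0..<m} \<times> {0..<w} \<union> shift m 0 Q"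

text \<open>Both ends are cut along the same profile, \<open>p\<close> apart, so that copies can be
  chained.\<close>

definition strip_period :: "int \<Rightarrow> cell set \<Rightarrow> int \<Rightarrow> cell set" where
  "strip_period w Q p = strip_end w Q p - Q"

text \<open>The vertical strip is the mirror image of the horizontal one, so the corner loses the
  profile and its reflection.\<close>

definition corner :: "int \<Rightarrow> cell set \<Rightarrow> cell set" where
  "corner w Q = {0..<w} \<times> {0..<w} - (Q \<union> prod.swap ` Q)"

text \<open>The bound by \<open>p\<close> keeps the profile within one period, the bounds by
  \<open>w\<close> within the strip and the corner. The last condition keeps the two strips from
  overlapping in the corner; it also excludes diagonal cells.\<close>

definition strip_profile :: "int \<Rightarrow> int \<Rightarrow> cell list \<Rightarrow> bool" where
  "strip_profile w p q \<longleftrightarrow> 0 \<le> w \<and> 0 \<le> p \<and> distinct q \<and>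
     (\<forall>(x, y) \<in> set q. 0 \<le> x \<and> x < p \<and> x < w \<and> 0 \<le> y \<and> y < w \<and> (y, x) \<notin> set q)"

lemma strip_profileD:
  assumes "strip_profile w p q"
  shows "0 \<le> w" and "0 \<le> p" and "distinct q"
    and "(x, y) \<in> set q \<Longrightarrow> 0 \<le> x \<and> x < p \<and> x < w \<and> 0 \<le> y \<and> y < w \<and> (y, x) \<notin> set q"
  using assms unfolding strip_profile_def by fast+

text \<open>The cells missing at the left of the period are exactly those by which the strip end
  protrudes beyond \<open>c\<close>, so the two pieces interlock.\<close>

lemma strip_end_add_period:
  assumes q: "strip_profile w p q" and "0 \<le> c"
    and "tileable (strip_end w (set q) c) g" and "tileable (strip_period w (set q) p) 0"
  shows "tileable (strip_end w (set q) (c + p)) g"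
proof -
  let ?A = "strip_end w (set q) c" and ?B = "shift c 0 (strip_period w (set q) p)"
  have "?A \<inter> ?B = {}"
    using \<open>0 \<le> c\<close> strip_profileD(4)[OF q]
    by (fastforce simp: strip_end_def strip_period_def mem_shift_iff)
  moreover have "?A \<union> ?B = strip_end w (set q) (c + p)"
  proof (intro set_eqI, clarify)
    fix x y
    show "(x, y) \<in> ?A \<union> ?B \<longleftrightarrow> (x, y) \<in> strip_end w (set q) (c + p)"
      using \<open>0 \<le> c\<close> strip_profileD(2)[OF q] strip_profileD(4)[OF q, of "x - c" y]
        strip_profileD(4)[OF q, of "x - c - p" y]
      by (auto simp: strip_end_def strip_period_def mem_shift_iff algebra_simps)
  qed
  ultimately show ?thesis
    using tileable_Un[OF assms(3) tileable_shift[OF assms(4), of c 0]] by simp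
qed

lemma strip_end_add_periods:
  assumes "strip_profile w p q" and "0 \<le> c"
    and "tileable (strip_end w (set q) c) g" and "tileable (strip_period w (set q) p) 0"
  shows "tileable (strip_end w (set q) (c + int i * p)) g"
proof (induction i)
  case 0
  then show ?case
    using assms(3) by simp
next
  case (Suc i)
  then show ?case
    using strip_end_add_period[OF assms(1) _ Suc.IH assms(4)] assms(2) strip_profileD(2)[OF assms(1)]
    by (simp add: algebra_simps)
qed

section \<open>Rectangles put side by side\<close>

lemma tileable_rectangle_add:
  assumes "tileable ({0..<a} \<times> {0..<b}) 0" and "tileable ({0..<c} \<times> {0..<b}) 0"
    and "0 \<le> a" and "0 \<le> c"
  shows "tileable ({0..<a + c} \<times> {0..<b}) 0"
proof -
  have "{0..<a} \<times> {0..<b} \<inter> shift a 0 ({0..<c} \<times> {0..<b}) = {}"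
    by (auto simp: mem_shift_iff)
  moreover have "{0..<a} \<times> {0..<b} \<union> shift a 0 ({0..<c} \<times> {0..<b}) = {0..<a + c} \<times> {0..<b}"
    using assms(3,4) by (auto simp: mem_shift_iff)
  ultimately show ?thesis
    using tileable_Un[OF assms(1) tileable_shift[OF assms(2), of a 0]] by simp
qed

lemma tileable_rectangle_mult:
  assumes "tileable ({0..<a} \<times> {0..<b}) 0" and "0 \<le> a"
  shows "tileable ({0..<int k * a} \<times> {0..<b}) 0"
proof (induction k)
  case 0
  then show ?case
    by (simp add: tileable_empty)
next
  case (Suc k)
  then show ?case
    using tileable_rectangle_add[OF Suc.IH assms(1)] assms(2) by (simp add: algebra_simps)
qed

lemma tileable_rectangle_transpose:
  assumes "tileable ({0..<a} \<times> {0..<b}) g"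
  shows "tileable ({0..<b} \<times> {0..<a}) g"
  using tileable_swap[OF assms] by (simp add: product_swap)

text \<open>One tiled strip end serves twice, on top and reflected on the right, which explains the
  factor 2.\<close>

lemma square_of_strips:
  assumes q: "strip_profile w p q" and "0 \<le> m"
    and blocks: "tileable ({0..<m} \<times> {0..<m}) 0"
    and strip: "tileable (strip_end w (set q) m) g"
    and corner: "tileable (corner w (set q)) h"
  shows "tileable ({0..<m + w} \<times> {0..<m + w}) (2 * g + h)"
proof -
  let ?B = "{0..<m} \<times> {0..<m}" and ?T = "shift 0 m (strip_end w (set q) m)"
    and ?C = "shift m m (corner w (set q))"
  let ?R = "prod.swap ` ?T"
  note defs = strip_end_def corner_def mem_shift_iff mem_swap_iff
  \<comment> \<open>The two strips can meet only inside the corner square, where the asymmetry of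
    the profile keeps them apart.\<close>
  have "?B \<inter> ?T = {}" "(?B \<union> ?T) \<inter> ?R = {}" "(?B \<union> ?T \<union> ?R) \<inter> ?C = {}"
    using \<open>0 \<le> m\<close> strip_profileD(4)[OF q] by (fastforce simp: defs)+
  then have "tileable (?B \<union> ?T \<union> ?R \<union> ?C) (0 + g + g + h)"
    by (intro tileable_Un tileable_swap tileable_shift assms)
  moreover have "?B \<union> ?T \<union> ?R \<union> ?C = {0..<m + w} \<times> {0..<m + w}"
  proof (intro set_eqI, clarify)
    fix x y
    show "(x, y) \<in> ?B \<union> ?T \<union> ?R \<union> ?C \<longleftrightarrow> (x, y) \<in> {0..<m + w} \<times> {0..<m + w}"
      using \<open>0 \<le> m\<close> strip_profileD(1)[OF q] strip_profileD(4)[OF q, of "x - m" "y - m"]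
        strip_profileD(4)[OF q, of "y - m" "x - m"]
      by (auto simp: defs)
  qed
  ultimately show ?thesis
    by (simp add: mult_2)
qed

section \<open>The exhibited tilings\<close>

text \<open>The cells run column by column, which is the lexicographic order that the encoding
  relies on.\<close>

definition rectangle_cells :: "int \<Rightarrow> int \<Rightarrow> cell list" where
  "rectangle_cells a b = List.product [0..a - 1] [0..b - 1]"

lemma set_rectangle_cells: "set (rectangle_cells a b) = {0..<a} \<times> {0..<b}"
  unfolding rectangle_cells_def by auto

lemma distinct_rectangle_cells: "distinct (rectangle_cells a b)"
  unfolding rectangle_cells_def by (simp add: distinct_product)

text \<open>Appending the shifted profile preserves lexicographic order, since its cells lie right
  of the rectangle and the profiles below are listed in that order.\<close>

definition strip_end_cells :: "int \<Rightarrow> cell list \<Rightarrow> int \<Rightarrow> cell list" where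
  "strip_end_cells w q m = rectangle_cells m w @ map (\<lambda>(x, y). (x + m, y)) q"

lemma set_strip_end_cells: "set (strip_end_cells w q m) = strip_end w (set q) m"
  unfolding strip_end_cells_def strip_end_def shift_def by (simp add: set_rectangle_cells)

lemma distinct_strip_end_cells:
  assumes "strip_profile w p q"
  shows "distinct (strip_end_cells w q m)"
  using strip_profileD[OF assms]
  by (fastforce simp: strip_end_cells_def set_rectangle_cells distinct_rectangle_cells
      distinct_map inj_on_def)

lemma tileable_square_of_shapes:
  assumes "shapes_cover ds (rectangle_cells (int n) (int n))" and "count_list ds M \<le> g"
  shows "tileable (square n) g"
  using tileable_of_shapes[OF assms(1) distinct_rectangle_cells] assms(2)
  by (auto simp: set_rectangle_cells square_def intro: tileable_mono)

lemma tileable_strip_end_of_shapes: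
  assumes "strip_profile w p q"
    and "shapes_cover ds (strip_end_cells w q c)" and "count_list ds M \<le> g"
  shows "tileable (strip_end w (set q) c) g"
  using tileable_of_shapes[OF assms(2) distinct_strip_end_cells[OF assms(1)]] assms(3)
  by (auto simp: set_strip_end_cells intro: tileable_mono)

lemma tileable_strip_period_of_shapes:
  assumes "strip_profile w p q"
    and "shapes_cover ds (filter (\<lambda>c. c \<notin> set q) (strip_end_cells w q p))"
    and "count_list ds M \<le> g"
  shows "tileable (strip_period w (set q) p) g"
proof -
  have "set (filter (\<lambda>c. c \<notin> set q) (strip_end_cells w q p)) = strip_period w (set q) p"
    by (auto simp: strip_period_def set_strip_end_cells)
  then show ?thesis
    using tileable_of_shapes[OF assms(2)] distinct_strip_end_cells[OF assms(1)] assms(3)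
    by (auto intro: tileable_mono)
qed

lemma tileable_corner_of_shapes:
  assumes "shapes_cover ds
      (filter (\<lambda>c. c \<notin> set q \<and> prod.swap c \<notin> set q) (rectangle_cells w w))"
    and "count_list ds M \<le> g"
  shows "tileable (corner w (set q)) g"
proof -
  have "set (filter (\<lambda>c. c \<notin> set q \<and> prod.swap c \<notin> set q) (rectangle_cells w w)) = corner w (set q)"
    by (auto simp: corner_def set_rectangle_cells mem_swap_iff)
  then show ?thesis
    using tileable_of_shapes[OF assms(1)] distinct_rectangle_cells assms(2)
    by (auto intro: tileable_mono)
qed

section \<open>Small squares outside the reach of the strip construction\<close>

lemma tileable_square_2: "tileable (square 2) 4"
  by (rule tileable_square_of_shapes[where ds = "
    [M, M, M, M]"]) code_simp+

lemma tileable_square_6: "tileable (square 6) 4"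
  by (rule tileable_square_of_shapes[where ds = "
    [E, E, M, W, M, S, N, E, W, M, W, M]"]) code_simp+

lemma tileable_square_1: "tileable (square 1) 5"
  by (rule tileable_square_of_shapes[where ds = "
    [M]"]) code_simp+

lemma tileable_square_3: "tileable (square 3) 5"
  by (rule tileable_square_of_shapes[where ds = "
    [E, M, M, M, M, M]"]) code_simp+

lemma tileable_square_5: "tileable (square 5) 5"
  by (rule tileable_square_of_shapes[where ds = "
    [M, E, S, M, W, M, M, W, E, M]"]) code_simp+

lemma tileable_square_7: "tileable (square 7) 5"
  by (rule tileable_square_of_shapes[where ds = "
    [E, W, E, N, S, E, W, M, W, M, S, M, E, W, M, M]"]) code_simp+

lemma tileable_square_9: "tileable (square 9) 5"
  by (rule tileable_square_of_shapes[where ds = "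
    [N, M, E, W, E, N, M, S, S, N, E, S, M, S, N, W, N, E, M, S, W, E, W, M]"]) code_simp+

lemma tileable_square_11: "tileable (square 11) 5"
  by (rule tileable_square_of_shapes[where ds = "
    [N, E, S, N, E, M, S, W, E, M, N, M, S, E, W, E, N, S, S, N, E, S, N, N, M, N, W, S, W, W, E, W,
     W, M]"]) code_simp+

lemma tileable_square_13: "tileable (square 13) 5"
  by (rule tileable_square_of_shapes[where ds = "
    [E, E, E, W, E, N, N, M, S, N, S, S, N, M, S, S, N, W, S, N, M, W, E, S, N, S, N, S, N, N, W, S,
     S, N, S, N, W, E, N, M, W, W, E, W, E, M]"]) code_simp+

lemma tileable_square_15: "tileable (square 15) 5"
  by (rule tileable_square_of_shapes[where ds = "
    [E, W, E, W, E, N, E, N, M, S, N, E, W, E, S, S, S, N, E, W, E, W, N, M, W, N, S, E, S, S, N, W,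
     E, W, S, S, N, M, S, M, W, E, W, S, N, N, N, E, W, E, S, N, M, S, W, E, W, E, W, W]"]) code_simp+

lemma tileable_square_17: "tileable (square 17) 5"
  by (rule tileable_square_of_shapes[where ds = "
    [N, E, W, E, W, E, S, E, S, N, M, W, E, W, E, S, N, N, N, M, W, E, W, E, E, S, W, E, N, N, E, W,
     E, M, S, W, E, N, N, M, S, N, E, S, S, W, E, W, S, N, S, S, N, E, W, E, W, S, N, M, S, N, W, E,
     W, E, S, N, S, N, W, E, W, W, E, W]"]) code_simp+

lemma tileable_square_19: "tileable (square 19) 5"
  by (rule tileable_square_of_shapes[where ds = "
    [E, S, E, W, E, W, E, W, E, N, N, S, S, S, N, E, W, E, S, N, N, M, W, W, S, N, E, S, N, N, M, S,
     N, E, W, E, E, S, W, E, E, W, E, S, N, E, W, M, W, W, E, E, S, N, E, E, E, W, E, S, N, E, S, S,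
     N, N, S, S, S, N, E, N, N, W, W, E, W, S, W, W, W, M, N, M, N, S, N, S, N, S, W, W, W, W]"]) code_simp+

lemma tileable_square_21: "tileable (square 21) 5"
  by (rule tileable_square_of_shapes[where ds = "
    [E, M, W, E, W, E, S, N, E, W, E, N, N, M, S, E, W, E, E, W, E, W, N, E, S, S, N, S, N, E, E, W,
     E, E, W, N, N, E, E, S, E, S, N, E, S, W, E, N, S, S, W, S, S, N, N, E, S, N, N, N, E, S, S, N,
     N, S, W, N, S, W, N, S, W, S, S, N, W, S, N, E, E, S, W, S, N, N, E, E, W, S, S, N, E, S, N, S,
     S, W, S, W, N, M, N, S, S, W, M, W, E, W, E, W, W, M]"]) code_simp+

lemma tileable_square_23: "tileable (square 23) 5"
  by (rule tileable_square_of_shapes[where ds = "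
    [N, E, E, W, E, W, E, E, S, N, E, S, N, S, N, S, M, S, N, E, S, N, W, S, E, N, N, N, E, E, E, W,
     E, W, E, E, S, W, M, S, S, S, E, E, S, E, S, N, E, W, E, W, N, N, N, N, N, S, W, W, S, W, E, S,
     W, W, E, S, S, N, E, E, S, N, N, E, S, N, E, W, S, W, N, N, N, W, S, E, W, S, N, E, S, W, E, W,
     W, S, S, N, N, S, N, N, E, S, N, W, E, S, W, S, W, N, S, W, E, W, E, E, N, M, M, S, N, N, E, S,
     W, W, W, E, W, E, W, M]"]) code_simp+

lemma tileable_square_25: "tileable (square 25) 5"
  by (rule tileable_square_of_shapes[where ds = "
    [E, S, E, S, N, E, E, S, M, S, E, W, E, N, N, S, N, N, S, N, N, S, S, W, S, M, S, S, S, N, N, S,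
     S, N, S, N, E, S, N, N, N, M, W, S, W, E, E, W, S, W, W, E, S, S, N, E, E, N, W, E, W, N, E, N,
     N, E, S, W, S, S, W, E, N, E, S, W, N, W, E, S, S, S, W, N, W, W, S, E, W, S, S, W, E, S, S, N,
     E, W, W, S, W, W, N, S, S, N, S, W, E, S, N, S, N, N, E, N, N, W, W, E, S, W, S, E, S, W, W, E,
     S, N, E, W, N, E, W, N, N, E, E, W, W, W, E, W, M, S, S, N, E, W, W, E, W, E, W, E, W, E, W, M]"]) code_simp+

lemma tileable_square_27: "tileable (square 27) 5"
  by (rule tileable_square_of_shapes[where ds = "
    [N, E, W, M, E, S, N, E, S, N, E, W, E, W, E, N, S, S, N, E, S, E, S, N, E, W, E, W, E, S, N, S,
     N, N, W, S, S, W, N, E, W, N, E, S, S, E, W, E, E, S, S, N, E, W, N, N, N, S, S, N, N, N, N, W,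
     E, S, M, S, S, S, S, W, N, N, S, N, W, W, S, S, S, W, N, N, W, W, N, N, E, S, N, W, S, N, E, W,
     N, W, E, W, W, M, S, W, E, W, S, E, W, E, W, E, W, E, N, N, N, E, E, S, S, N, W, E, W, E, W, E,
     W, S, W, N, S, W, S, W, E, W, E, W, E, W, N, E, E, W, W, E, E, S, N, E, W, E, E, S, M, S, N, S,
     N, N, E, E, S, N, W, W, E, N, W, S, N, S, M, W, W, E, W, E, W, W, E, W, E, W]"]) code_simp+

section \<open>Strips of width 6, for sides congruent to 2 modulo 4\<close>

definition profile6 :: "cell list" where
  "profile6 =
    [(0, 1), (0, 2), (0, 4), (0, 5), (1, 5)]"

lemma profile6_strip_profile: "strip_profile 6 4 profile6"
  by code_simp

lemma tileable_period6: "tileable (strip_period 6 (set profile6) 4) 0"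
  by (rule tileable_strip_period_of_shapes[OF profile6_strip_profile, where ds = "
    [N, W, S, N, E, S]"]) code_simp+

text \<open>The area of a region fixes its number of monominoes modulo 4. Here the area is 36 - 2 *
  5 = 26, so two is the least possible; the corners of widths 15 and 17 have areas 207 and 263, so
  three is the least there.\<close>

lemma tileable_corner6: "tileable (corner 6 (set profile6)) 2"
  by (rule tileable_corner_of_shapes[where ds = "
    [M, W, M, S, E, S, N, W]"]) code_simp+

text \<open>The period is 4, so this one length leads to every positive multiple of 4.\<close>

lemma tileable_strip_end6_4: "tileable (strip_end 6 (set profile6) 4) 1"
  by (rule tileable_strip_end_of_shapes[OF profile6_strip_profile, where ds = "
    [N, E, W, M, S, N, E, S]"]) code_simp+

section \<open>Strips of width 15, for sides congruent to 3 modulo 4\<close>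

definition profile15 :: "cell list" where
  "profile15 =
    [(0, 1), (0, 3), (0, 5), (0, 9), (0, 10), (0, 12), (0, 13), (0, 14), (1, 9)]"

lemma profile15_strip_profile: "strip_profile 15 16 profile15"
  by code_simp

lemma tileable_period15: "tileable (strip_period 15 (set profile15) 16) 0"
  by (rule tileable_strip_period_of_shapes[OF profile15_strip_profile, where ds = "
    [N, N, N, E, S, N, N, E, S, S, S, S, S, S, W, N, N, N, S, W, N, S, N, W, N, E, S, S, E, W, E, E,
     S, N, E, S, S, E, S, W, N, N, N, W, N, N, E, W, S, S, W, S, N, S, S, N, W, E, N, W]"]) code_simp+

lemma tileable_corner15: "tileable (corner 15 (set profile15)) 3"
  by (rule tileable_corner_of_shapes[where ds = "
    [M, W, N, E, S, N, N, E, E, S, S, S, S, S, W, E, W, S, S, W, W, S, N, N, W, W, E, S, W, S, S, E,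
     W, W, W, S, N, W, S, N, E, S, W, W, S, N, M, N, W, E, W, E, W, M]"]) code_simp+

text \<open>The lengths 16, 20, 24 and 28 represent all multiples of 4 modulo the period 16.\<close>

lemma tileable_strip_end15_16: "tileable (strip_end 15 (set profile15) 16) 1"
  by (rule tileable_strip_end_of_shapes[OF profile15_strip_profile, where ds = "
    [N, E, W, E, E, W, E, W, M, S, S, N, E, E, S, W, E, W, N, N, W, W, N, E, S, S, S, E, E, N, N, E,
     S, S, N, N, W, N, S, W, S, S, N, E, S, N, W, E, N, N, W, S, S, W, S, N, S, S, N, W, E, N, W]"]) code_simp+

lemma tileable_strip_end15_20: "tileable (strip_end 15 (set profile15) 20) 1"
  by (rule tileable_strip_end_of_shapes[OF profile15_strip_profile, where ds = "
    [E, W, E, W, E, W, E, N, S, W, E, E, N, E, M, S, S, S, N, N, E, W, W, W, S, S, N, E, E, S, W, E,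
     W, N, N, W, W, N, E, S, S, W, E, E, N, E, S, S, N, E, S, W, N, N, W, S, W, N, E, S, W, E, W, N,
     E, W, S, W, S, N, E, S, S, N, W, E, N, W]"]) code_simp+

lemma tileable_strip_end15_24: "tileable (strip_end 15 (set profile15) 24) 1"
  by (rule tileable_strip_end_of_shapes[OF profile15_strip_profile, where ds = "
    [N, E, W, E, E, W, E, W, M, S, S, N, E, E, S, W, E, W, N, N, W, W, N, E, S, S, S, E, E, N, N, E,
     S, S, N, N, S, W, W, N, S, S, N, E, S, E, W, S, N, N, N, N, W, S, N, W, S, W, N, S, S, E, W, E,
     E, S, N, E, S, S, N, E, W, N, N, S, W, W, N, E, W, S, W, S, N, E, S, S, N, W, E, N, W]"]) code_simp+

lemma tileable_strip_end15_28: "tileable (strip_end 15 (set profile15) 28) 1"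
  by (rule tileable_strip_end_of_shapes[OF profile15_strip_profile, where ds = "
    [N, E, E, W, E, W, E, S, N, S, W, E, W, E, M, S, S, N, N, E, W, E, W, W, S, S, N, E, E, S, W, E,
     W, N, N, W, W, N, E, S, S, S, E, E, N, N, E, S, S, N, N, S, W, W, N, S, S, N, E, S, E, W, S, N,
     N, N, N, W, S, N, W, S, W, N, S, S, E, N, E, E, S, S, N, E, S, W, S, W, N, N, W, E, W, N, E, W,
     S, W, S, N, E, S, S, N, W, E, N, W]"]) code_simp+

section \<open>Strips of width 17, for sides congruent to 1 modulo 4\<close>

definition profile17 :: "cell list" where
  "profile17 =
    [(0, 4), (0, 5), (0, 6), (0, 7), (0, 8), (0, 9), (0, 10), (0, 11), (0, 15), (0, 16), (1, 5), (1,
     7), (1, 15)]"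

lemma profile17_strip_profile: "strip_profile 17 16 profile17"
  by code_simp

lemma tileable_period17: "tileable (strip_period 17 (set profile17) 16) 0"
  by (rule tileable_strip_period_of_shapes[OF profile17_strip_profile, where ds = "
    [N, E, E, S, N, N, N, E, S, S, S, W, S, W, E, S, W, N, E, N, N, S, N, E, E, W, W, N, N, E, S, S,
     W, E, S, N, E, W, N, W, W, E, S, N, W, S, N, S, N, E, N, S, E, S, S, S, N, N, N, N, S, W, S, W,
     S, S, W, N]"]) code_simp+

lemma tileable_corner17: "tileable (corner 17 (set profile17)) 3"
  by (rule tileable_corner_of_shapes[where ds = "
    [N, E, E, S, N, N, N, E, W, N, M, S, S, N, W, N, N, E, W, W, E, S, S, W, E, E, E, S, E, W, E, S,
     N, E, W, W, W, N, N, W, W, W, S, E, S, W, W, E, N, N, S, N, S, S, N, W, S, N, S, M, S, W, E, W,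
     W, E, W, M]"]) code_simp+

text \<open>The lengths 12, 16, 20 and 24 again represent all multiples of 4 modulo 16.\<close>

lemma tileable_strip_end17_12: "tileable (strip_end 17 (set profile17) 12) 1"
  by (rule tileable_strip_end_of_shapes[OF profile17_strip_profile, where ds = "
    [N, E, W, E, N, M, E, W, E, S, W, S, S, N, E, E, S, N, N, E, S, S, N, N, W, W, E, W, S, W, E, W,
     S, S, N, E, N, N, E, E, S, S, S, S, N, N, N, S, W, S, W, S, S, W, N]"]) code_simp+

lemma tileable_strip_end17_16: "tileable (strip_end 17 (set profile17) 16) 1"
  by (rule tileable_strip_end_of_shapes[OF profile17_strip_profile, where ds = "
    [N, E, W, E, W, E, S, N, E, S, S, N, E, E, S, M, W, W, S, N, N, W, N, E, W, E, S, W, S, S, N, E,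
     E, S, N, N, E, S, S, N, N, W, W, E, W, S, S, E, W, S, S, N, N, E, W, N, E, S, S, S, N, N, N, E,
     S, W, S, W, S, S, W, N]"]) code_simp+

lemma tileable_strip_end17_20: "tileable (strip_end 17 (set profile17) 20) 1"
  by (rule tileable_strip_end_of_shapes[OF profile17_strip_profile, where ds = "
    [N, E, W, E, S, N, E, N, E, S, S, S, N, E, N, M, W, W, S, W, N, W, E, N, E, N, E, S, S, S, S, N,
     E, S, W, E, W, N, N, W, S, S, N, N, E, S, W, E, S, S, S, W, N, N, E, S, S, W, E, S, N, W, N, W,
     N, S, N, W, S, E, W, S, S, N, N, E, N, S, N, E, S, S, W, W, W, N, W, N, E]"]) code_simp+

lemma tileable_strip_end17_24: "tileable (strip_end 17 (set profile17) 24) 1"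
  by (rule tileable_strip_end_of_shapes[OF profile17_strip_profile, where ds = "
    [E, S, N, E, N, E, W, E, S, N, S, N, W, W, M, E, S, N, S, N, W, E, W, E, W, S, N, W, N, E, E, E,
     W, S, S, N, N, E, S, W, E, S, N, W, E, W, N, E, N, N, W, S, W, E, S, S, W, N, E, N, E, S, S, S,
     N, N, N, E, S, E, S, W, W, N, E, W, N, S, W, E, E, N, E, S, S, N, E, E, W, W, E, S, S, N, N, N,
     E, S, W, E, S, W, S, S, W, N]"]) code_simp+

section \<open>Assembly of squares from blocks, strips and corners\<close>

lemma tileable_square_4: "tileable (square 4) 0"
  by (rule tileable_square_of_shapes[where ds = "[N, E, S, W]"]) code_simp+

lemma tileable_block: "tileable ({0..<4} \<times> {0..<4}) 0"
  using tileable_square_4 by (simp add: square_def)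

lemma tileable_square_of_blocks:
  assumes "4 dvd m" and "0 \<le> m"
  shows "tileable ({0..<m} \<times> {0..<m}) 0"
proof -
  define k where "k = nat (m div 4)"
  have m: "m = int k * 4"
    using assms by (simp add: k_def pos_imp_zdiv_nonneg_iff)
  have "tileable ({0..<m} \<times> {0..<4}) 0"
    using tileable_rectangle_mult[OF tileable_block, of k] m by simp
  \<comment> \<open>The row of \<open>k\<close> blocks is transposed into a \<open>4\<close> by
    \<open>m\<close> rectangle, which is then itself repeated \<open>k\<close> times.\<close>
  then show ?thesis
    using tileable_rectangle_mult[OF tileable_rectangle_transpose, of m 4 k] m by simp
qed

text \<open>With \<open>m = c + int i * p\<close>, the 2 counts one monomino for each of the two
  strips; blocks and inserted periods cost nothing.\<close>

lemma tileable_square_of_pieces: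
  assumes "strip_profile w p q" and "tileable (strip_period w (set q) p) 0"
    and "tileable (corner w (set q)) h" and "tileable (strip_end w (set q) c) 1"
    and "4 dvd c" and "0 \<le> c" and "4 dvd p" and "int n = c + int i * p + w"
  shows "tileable (square n) (2 + h)"
proof -
  have "tileable (strip_end w (set q) (c + int i * p)) 1"
    by (rule strip_end_add_periods) (use assms in auto)
  moreover have "tileable ({0..<c + int i * p} \<times> {0..<c + int i * p}) 0"
    by (rule tileable_square_of_blocks) (use assms strip_profileD(2)[OF assms(1)] in auto)
  ultimately show ?thesis
    using square_of_strips[OF assms(1), of "c + int i * p" 1 h] assms strip_profileD(2)[OF assms(1)]
    by (simp add: square_def)
qed

lemma tileable_square_1_mod_4:
  assumes "n mod 4 = 1"
  shows "tileable (square n) 5"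
proof (cases "n < 29")
  case True
  then have "n \<in> {1, 5, 9, 13, 17, 21, 25}"
    using assms by simp presburger
  then show ?thesis
    using tileable_square_1 tileable_square_5 tileable_square_9 tileable_square_13
      tileable_square_17 tileable_square_21 tileable_square_25 by fastforce
next
  case False
  \<comment> \<open>29 = 12 + 17 is the shortest strip end plus the width. In this branch
    \<open>29 \<le> n\<close>, so the subtraction is not truncated.\<close>
  define i where "i = (n - 29) div 16"
  have "n = 12 + i * 16 + 17 \<or> n = 16 + i * 16 + 17 \<or> n = 20 + i * 16 + 17 \<or> n = 24 + i * 16 + 17"
    using assms False unfolding i_def by presburger
  then have "int n = 12 + int i * 16 + 17 \<or> int n = 16 + int i * 16 + 17 \<or>
      int n = 20 + int i * 16 + 17 \<or> int n = 24 + int i * 16 + 17"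
    by linarith
  then show ?thesis
    using tileable_square_of_pieces[OF profile17_strip_profile tileable_period17 tileable_corner17,
        where i = i and n = n]
      tileable_strip_end17_12 tileable_strip_end17_16 tileable_strip_end17_20 tileable_strip_end17_24
    by fastforce
qed

lemma tileable_square_3_mod_4:
  assumes "n mod 4 = 3"
  shows "tileable (square n) 5"
proof (cases "n < 31")
  case True
  then have "n \<in> {3, 7, 11, 15, 19, 23, 27}"
    using assms by simp presburger
  then show ?thesis
    using tileable_square_3 tileable_square_7 tileable_square_11 tileable_square_15
      tileable_square_19 tileable_square_23 tileable_square_27 by fastforce
next
  case False
  \<comment> \<open>Likewise 31 = 16 + 15, the shortest strip end plus the width.\<close>
  define i where "i = (n - 31) div 16"
  have "n = 16 + i * 16 + 15 \<or> n = 20 + i * 16 + 15 \<or> n = 24 + i * 16 + 15 \<or> n = 28 + i * 16 + 15"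
    using assms False unfolding i_def by presburger
  then have "int n = 16 + int i * 16 + 15 \<or> int n = 20 + int i * 16 + 15 \<or>
      int n = 24 + int i * 16 + 15 \<or> int n = 28 + int i * 16 + 15"
    by linarith
  then show ?thesis
    using tileable_square_of_pieces[OF profile15_strip_profile tileable_period15 tileable_corner15,
        where i = i and n = n]
      tileable_strip_end15_16 tileable_strip_end15_20 tileable_strip_end15_24 tileable_strip_end15_28
    by fastforce
qed

lemma tileable_square_2_mod_4:
  assumes "n mod 4 = 2"
  shows "tileable (square n) 4"
proof (cases "n < 10")
  case True
  then have "n \<in> {2, 6}"
    using assms by simp presburger
  then show ?thesis
    using tileable_square_2 tileable_square_6 by blast
next
  case False
  \<comment> \<open>Here 10 = 4 + 6, and the number of inserted periods is
    \<open>(n - 10) div 4\<close>.\<close>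
  have "n = 4 + (n - 10) div 4 * 4 + 6"
    using assms False by presburger
  then have "int n = 4 + int ((n - 10) div 4) * 4 + 6"
    by linarith
  then show ?thesis
    using tileable_square_of_pieces[OF profile6_strip_profile tileable_period6 tileable_corner6
        tileable_strip_end6_4] by simp
qed

theorem theorem1:
  fixes n :: nat
  assumes "n > 0"
  shows "\<exists>P. tiling (T_tetrominoes \<union> monominoes) P (square n) \<and> card (P \<inter> monominoes) \<le> 5"
proof -
  have "4 dvd n \<or> n mod 4 = 1 \<or> n mod 4 = 2 \<or> n mod 4 = 3"
    by presburger
  then consider "4 dvd n" | "n mod 4 = 1" | "n mod 4 = 2" | "n mod 4 = 3"
    by blast
  then have "tileable (square n) 5"
  proof cases
    case 1
    then have "4 dvd int n"
      by presburger
    then have "tileable (square n) 0"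
      using tileable_square_of_blocks[of "int n"] by (simp add: square_def)
    then show ?thesis
      by (rule tileable_mono) simp
  next
    case 2
    then show ?thesis
      by (rule tileable_square_1_mod_4)
  next
    case 3
    then show ?thesis
      by (rule tileable_square_2_mod_4[THEN tileable_mono]) simp
  next
    case 4
    then show ?thesis
      by (rule tileable_square_3_mod_4)
  qed
  then show ?thesis
    unfolding tileable_def .
qed

end
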